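(* Let $k\geqslant3$ and let $G$ be a $d$-regular graph. Suppose $\alpha\neq0$ is an eigenvalue of (the adjacency matrix of) $G$. Then every root $x\in\mathbb{C}$ of $(x-d)(x-1)^{\frac{k-2}{2}}-\alpha=0$ is an eigenvalue of the signless Laplacian tensor $\mathcal{Q}_{G^k}$. Moreover, $\rho(\mathcal{Q}_{G^k})$ equals the largest real root of $(x-d)(x-1)^{\frac{k-2}{2}}-d=0$.
   Context: A graph is a finite simple undirected graph; it is $d$-regular if every vertex has exactly $d$ neighbours. For $k\geqslant3$, the $k$th power $G^k$ is the $k$-uniform hypergraph with vertex set $V(G)\cup\{i_{e,j}: e\in E(G),\ j\in[k-2]\}$ (new distinct vertices $i_{e,j}$) and edge set $\{e\cup\{i_{e,1},\ldots,i_{e,k-2}\}: e\in E(G)\}$. For a $k$-uniform hypergraph $H$ on $n$ vertices: the adjacency tensor $\mathcal{A}_H$ has entries $\frac{1}{(k-1)!}$ at $(i_1,\ldots,i_k)$ if $\{i_1,\ldots,i_k\}\in E(H)$ and $0$ otherwise; $\mathcal{D}_H$ is the diagonal tensor with the degree of $i$ at $(i,\ldots,i)$; $\mathcal{Q}_H=\mathcal{D}_H+\mathcal{A}_H$. For an order $k$ dimension $n$ tensor $\mathcal{T}$, $(\mathcal{T}y)_i=\sum_{i_2,\ldots,i_k}t_{ii_2\cdots i_k}y_{i_2}\cdots y_{i_k}$; $\lambda\in\mathbb{C}$ is an eigenvalue if $\mathcal{T}y=\lambda y^{[k-1]}$ for some nonzero $y\in\mathbb{C}^n$, with $y^{[k-1]}=(y_1^{k-1},\ldots,y_n^{k-1})^\top$;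 $\rho(\mathcal{T})$ is the maximum modulus of eigenvalues. When $k$ is odd, $(x-1)^{\frac{k-2}{2}}$ means $s^{k-2}$ for a choice of square root $s$ of $x-1$ (a root is any $x$ for which some such choice satisfies the equation), and for real $x\geqslant1$ it is the nonnegative real value. *)

theory Defs
  imports Complex_Main "Jordan_Normal_Form.Char_Poly"
begin

definition simple_graph :: "'v set \<Rightarrow> 'v set set \<Rightarrow> bool" where
  "simple_graph V E \<longleftrightarrow> finite V \<and> (\<forall>e\<in>E. e \<subseteq> V \<and> card e = 2)"

definition regular_graph :: "'v set \<Rightarrow> 'v set set \<Rightarrow> nat \<Rightarrow> bool" where
  "regular_graph V E d \<longleftrightarrow> (\<forall>v\<in>V. card {u \<in> V. {u, v} \<in> E} = d)"

text \<open>Matrices are indexed by initial segments of the naturals, so the adjacency matrix is taken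
  with respect to an enumeration \<open>vs\<close> of the vertices; its eigenvalues do not depend on \<open>vs\<close>.\<close>

definition adjacency_matrix :: "'v list \<Rightarrow> 'v set set \<Rightarrow> complex mat" where
  "adjacency_matrix vs E =
     mat (length vs) (length vs) (\<lambda>(i, j). if {vs ! i, vs ! j} \<in> E then 1 else 0)"

definition graph_eigenvalue :: "'v set \<Rightarrow> 'v set set \<Rightarrow> complex \<Rightarrow> bool" where
  "graph_eigenvalue V E \<alpha> \<longleftrightarrow>
     (\<exists>vs. distinct vs \<and> set vs = V \<and> eigenvalue (adjacency_matrix vs E) \<alpha>)"

datatype 'v power_vertex = Orig 'v | New "'v set" nat

definition power_vertices :: "nat \<Rightarrow> 'v set \<Rightarrow> 'v set set \<Rightarrow> 'v power_vertex set" where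
  "power_vertices k V E = Orig ` V \<union> {New e j | e j. e \<in> E \<and> j \<in> {1..k-2}}"

definition power_edges :: "nat \<Rightarrow> 'v set set \<Rightarrow> 'v power_vertex set set" where
  "power_edges k E = {Orig ` e \<union> New e ` {1..k-2} | e. e \<in> E}"

text \<open>A tensor of order \<open>k\<close> whose indices range over a finite set \<open>I\<close> is a function on lists;
  only its values at lists of length \<open>k\<close> over \<open>I\<close> matter. Likewise only the
  values on \<open>I\<close> of a vector \<open>y\<close> matter.\<close>

definition tensor_apply ::
  "nat \<Rightarrow> 'a set \<Rightarrow> ('a list \<Rightarrow> complex) \<Rightarrow> ('a \<Rightarrow> complex) \<Rightarrow> 'a \<Rightarrow> complex" where
  "tensor_apply k I T y i =
     (\<Sum>js | length js = k - 1 \<and> set js \<subseteq> I. T (i # js) * prod_list (map y js))"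

definition tensor_eigenvalue ::
  "nat \<Rightarrow> 'a set \<Rightarrow> ('a list \<Rightarrow> complex) \<Rightarrow> complex \<Rightarrow> bool" where
  "tensor_eigenvalue k I T ev \<longleftrightarrow>
     (\<exists>y. (\<exists>i\<in>I. y i \<noteq> 0) \<and> (\<forall>i\<in>I. tensor_apply k I T y i = ev * y i ^ (k - 1)))"

definition is_tensor_spectral_radius ::
  "nat \<Rightarrow> 'a set \<Rightarrow> ('a list \<Rightarrow> complex) \<Rightarrow> real \<Rightarrow> bool" where
  "is_tensor_spectral_radius k I T r \<longleftrightarrow>
     (\<exists>ev. tensor_eigenvalue k I T ev \<and> cmod ev = r) \<and>
     (\<forall>ev. tensor_eigenvalue k I T ev \<longrightarrow> cmod ev \<le> r)"

definition adjacency_tensor :: "nat \<Rightarrow> 'a set set \<Rightarrow> 'a list \<Rightarrow> complex" where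
  "adjacency_tensor k H js = (if set js \<in> H then 1 / fact (k - 1) else 0)"

definition degree_tensor :: "nat \<Rightarrow> 'a set set \<Rightarrow> 'a list \<Rightarrow> complex" where
  "degree_tensor k H js =
     (if js = replicate k (hd js) then of_nat (card {e \<in> H. hd js \<in> e}) else 0)"

definition signless_laplacian_tensor :: "nat \<Rightarrow> 'a set set \<Rightarrow> 'a list \<Rightarrow> complex" where
  "signless_laplacian_tensor k H js = degree_tensor k H js + adjacency_tensor k H js"

text \<open>The possible values of \<open>z\<close> to the power \<open>m/2\<close>: a genuine power for even \<open>m\<close>, and one value
  for each choice of square root of \<open>z\<close> for odd \<open>m\<close>.\<close>

definition half_powers :: "nat \<Rightarrow> complex \<Rightarrow> complex set" where
  "half_powers m z = (if even m then {z ^ (m div 2)} else {s ^ m | s. s\<^sup>2 = z})"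

text \<open>For a real base \<open>t \<ge> 0\<close> the power is the nonnegative real one.\<close>

definition real_half_powers :: "nat \<Rightarrow> real \<Rightarrow> complex set" where
  "real_half_powers m t =
     (if t \<ge> 0 then {of_real (sqrt t ^ m)} else half_powers m (of_real t))"

definition is_root :: "nat \<Rightarrow> nat \<Rightarrow> complex \<Rightarrow> complex \<Rightarrow> bool" where
  "is_root k d \<alpha> x \<longleftrightarrow> (\<exists>p \<in> half_powers (k - 2) (x - 1). (x - of_nat d) * p - \<alpha> = 0)"

definition is_real_root :: "nat \<Rightarrow> nat \<Rightarrow> complex \<Rightarrow> real \<Rightarrow> bool" where
  "is_real_root k d \<alpha> x \<longleftrightarrow>
     (\<exists>p \<in> real_half_powers (k - 2) (x - 1). (of_real x - of_nat d) * p - \<alpha> = 0)"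

definition is_largest_real_root :: "nat \<Rightarrow> nat \<Rightarrow> complex \<Rightarrow> real \<Rightarrow> bool" where
  "is_largest_real_root k d \<alpha> x \<longleftrightarrow>
     is_real_root k d \<alpha> x \<and> (\<forall>x'. is_real_root k d \<alpha> x' \<longrightarrow> x' \<le> x)"

end

theory Submission
  imports Defs "HOL-Combinatorics.Multiset_Permutations"
begin

text \<open>
  Let \<open>z\<close> be an eigenvector of the graph for \<open>\<alpha>\<close>, let \<open>s\<^sup>2 = x - 1\<close> with \<open>(x - d) s\<^sup>k\<^sup>-\<^sup>2 = \<alpha>\<close>, and
  choose \<open>t\<close> with \<open>t\<^sub>v\<^sup>k = z\<^sub>v\<close>. Then the vector with entry \<open>t\<^sub>v\<^sup>2\<close> at an original vertex \<open>v\<close> and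
  \<open>t\<^sub>u t\<^sub>v / s\<close> at every new vertex of the edge \<open>{u, v}\<close> is an eigenvector of the signless Laplacian
  tensor for \<open>x\<close>. For \<open>z = 1\<close>, \<open>\<alpha> = d\<close> and \<open>x\<close> the largest real root it is a positive eigenvector,
  and comparing any other eigenvector with it at an index where the ratio of moduli is largest
  bounds every eigenvalue by \<open>x\<close>.
\<close>

section \<open>Action of the degree, adjacency and signless Laplacian tensors on a vector\<close>

lemma degree_tensor_apply:
  assumes "finite I" "i \<in> I" "k \<ge> 1"
  shows "tensor_apply k I (degree_tensor k H) y i = of_nat (card {e \<in> H. i \<in> e}) * y i ^ (k - 1)"
proof -
  let ?L = "{js. length js = k - 1 \<and> set js \<subseteq> I}"
  let ?r = "replicate (k - 1) i"
  have fin: "finite ?L"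
    using finite_lists_length_eq[OF assms(1), of "k - 1"] by (simp add: conj_commute)
  have rep: "replicate k i = i # ?r"
    using assms(3) by (cases k) auto
  have "tensor_apply k I (degree_tensor k H) y i =
      (\<Sum>js\<in>?L. if js = ?r then of_nat (card {e \<in> H. i \<in> e}) * prod_list (map y js) else 0)"
    unfolding tensor_apply_def degree_tensor_def by (rule sum.cong) (auto simp: rep)
  also have "\<dots> = of_nat (card {e \<in> H. i \<in> e}) * prod_list (map y ?r)"
    using fin assms(2) by (subst sum.delta) auto
  finally show ?thesis by simp
qed

text \<open>A list of \<open>k\<close> entries covering a set of \<open>k\<close> elements cannot
  repeat an entry. Counting these orderings later cancels the weight
  \<open>1 / fact (k - 1)\<close>.\<close>

lemma lists_completing_edge:
  assumes "card e = k" "i \<in> e" "k \<ge> 1"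
  shows "{js. length js = k - 1 \<and> set (i # js) = e} = permutations_of_set (e - {i})"
proof -
  have fin: "finite e" using assms by (metis card.infinite not_one_le_zero)
  have "length js = k - 1 \<and> set (i # js) = e \<longleftrightarrow> set js = e - {i} \<and> distinct js" for js
  proof
    assume h: "length js = k - 1 \<and> set (i # js) = e"
    then have "card (set (i # js)) = length (i # js)" using assms by auto
    then have "distinct (i # js)" by (rule card_distinct)
    then show "set js = e - {i} \<and> distinct js" using h by auto
  next
    assume h: "set js = e - {i} \<and> distinct js"
    then have "length js = card (e - {i})" using distinct_card by metis
    then show "length js = k - 1 \<and> set (i # js) = e" using h assms fin by auto
  qed
  then show ?thesis by (auto simp: permutations_of_set_def)
qed

lemma adjacency_tensor_apply:
  assumes "finite I" "i \<in> I" "k \<ge> 1" and H: "\<And>e. e \<in> H \<Longrightarrow> e \<subseteq> I \<and> card e = k"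
  shows "tensor_apply k I (adjacency_tensor k H) y i = (\<Sum>e | e \<in> H \<and> i \<in> e. \<Prod>j\<in>e - {i}. y j)"
proof -
  let ?L = "{js. length js = k - 1 \<and> set js \<subseteq> I}"
  let ?H = "{e. e \<in> H \<and> i \<in> e}"
  let ?P = "\<lambda>e. {js. length js = k - 1 \<and> set (i # js) = e}"
  let ?f = "\<lambda>js. 1 / fact (k - 1) * prod_list (map y js)"
  have fin: "finite ?L"
    using finite_lists_length_eq[OF assms(1), of "k - 1"] by (simp add: conj_commute)
  have finH: "finite ?H"
    by (rule finite_subset[of _ "Pow I"]) (use H assms(1) in auto)
  have "tensor_apply k I (adjacency_tensor k H) y i =
      (\<Sum>js\<in>?L. if set (i # js) \<in> H then ?f js else 0)"
    unfolding tensor_apply_def adjacency_tensor_def by (rule sum.cong) auto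
  also have "\<dots> = (\<Sum>js\<in>{js \<in> ?L. set (i # js) \<in> H}. ?f js)"
    using fin by (subst sum.inter_filter) auto
  \<comment> \<open>Group the index lists by the edge they cover. Edges lie inside \<open>I\<close>,
    so \<open>?P e\<close> may drop the condition \<open>set js \<subseteq> I\<close>.\<close>
  also have "{js \<in> ?L. set (i # js) \<in> H} = (\<Union>e\<in>?H. ?P e)"
    using H by auto
  also have "(\<Sum>js\<in>(\<Union>e\<in>?H. ?P e). ?f js) = (\<Sum>e\<in>?H. \<Sum>js\<in>?P e. ?f js)"
  proof (rule sum.UNION_disjoint[OF finH])
    show "\<forall>e\<in>?H. finite (?P e)"
      by (intro ballI finite_subset[OF _ fin]) (use H in auto)
  qed auto
  also have "\<dots> = (\<Sum>e\<in>?H. \<Prod>j\<in>e - {i}. y j)"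
  proof (rule sum.cong[OF refl])
    fix e assume e: "e \<in> ?H"
    then have ce: "card e = k" "i \<in> e" using H by auto
    have fe: "finite e" using ce assms(3) by (metis card.infinite not_one_le_zero)
    have "(\<Sum>js\<in>?P e. ?f js) = (\<Sum>js\<in>permutations_of_set (e - {i}). ?f js)"
      by (simp only: lists_completing_edge[OF ce assms(3)])
    also have "\<dots> = (\<Sum>js\<in>permutations_of_set (e - {i}). 1 / fact (k - 1) * (\<Prod>j\<in>e - {i}. y j))"
      by (intro sum.cong refl)
        (auto simp: permutations_of_set_def prod.distinct_set_conv_list[symmetric])
    \<comment> \<open>The set \<open>e - {i}\<close> has \<open>k - 1\<close> elements, hence
      \<open>fact (k - 1)\<close> orderings with equal summands.\<close>
    also have "\<dots> = (\<Prod>j\<in>e - {i}. y j)"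
      using fe ce by simp
    finally show "(\<Sum>js\<in>?P e. ?f js) = (\<Prod>j\<in>e - {i}. y j)" .
  qed
  finally show ?thesis .
qed

lemma signless_laplacian_tensor_apply:
  assumes "finite I" "i \<in> I" "k \<ge> 1" "\<And>e. e \<in> H \<Longrightarrow> e \<subseteq> I \<and> card e = k"
  shows "tensor_apply k I (signless_laplacian_tensor k H) y i =
    of_nat (card {e \<in> H. i \<in> e}) * y i ^ (k - 1) + (\<Sum>e | e \<in> H \<and> i \<in> e. \<Prod>j\<in>e - {i}. y j)"
proof -
  have "tensor_apply k I (signless_laplacian_tensor k H) y i =
      tensor_apply k I (degree_tensor k H) y i + tensor_apply k I (adjacency_tensor k H) y i"
    unfolding tensor_apply_def signless_laplacian_tensor_def
    by (simp add: distrib_right sum.distrib)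
  then show ?thesis
    using degree_tensor_apply[OF assms(1-3)] adjacency_tensor_apply[OF assms] by simp
qed

section \<open>Bounding eigenvalues by a positive eigenvector\<close>

lemma prod_list_of_real:
  "prod_list (map (\<lambda>j. of_real (f j)) js) = (of_real (prod_list (map f js)) :: complex)"
  by (induction js) auto

lemma norm_prod_list_le:
  assumes "\<And>j. j \<in> set js \<Longrightarrow> cmod (y j) \<le> M * t j"
  shows "cmod (prod_list (map y js)) \<le> M ^ length js * prod_list (map t js)"
  using assms
proof (induction js)
  case (Cons a js)
  have "cmod (y a) * cmod (prod_list (map y js)) \<le> (M * t a) * (M ^ length js * prod_list (map t js))"
    \<comment> \<open>\<open>mult_mono\<close> requires \<open>M * t a \<ge> 0\<close>, which
      follows from \<open>0 \<le> cmod (y a) \<le> M * t a\<close>.\<close>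
    by (intro mult_mono Cons.IH) (use Cons.prems norm_ge_zero order_trans in \<open>auto, blast\<close>)
  then show ?case by (simp add: norm_mult mult_ac)
qed simp

text \<open>A Perron-Frobenius comparison: nonnegative entries preserve the bound
  \<open>cmod (y j) \<le> M * t j\<close> under the tensor. At an index where equality holds, the
  two eigenvalue equations compare \<open>cmod ev\<close> with \<open>r\<close>.\<close>

lemma tensor_eigenvalue_norm_le:
  fixes t :: "'a \<Rightarrow> real"
  assumes fin: "finite I" and pos: "\<And>i. i \<in> I \<Longrightarrow> t i > 0"
    and T: "\<And>js. T js = of_real (a js)" "\<And>js. a js \<ge> 0"
    and eig: "\<And>i. i \<in> I \<Longrightarrow>
      tensor_apply k I T (\<lambda>j. of_real (t j)) i = of_real r * of_real (t i) ^ (k - 1)"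
    and ev: "tensor_eigenvalue k I T ev"
  shows "cmod ev \<le> r"
proof -
  obtain y i0 where i0: "i0 \<in> I" "y i0 \<noteq> 0"
    and y: "\<And>i. i \<in> I \<Longrightarrow> tensor_apply k I T y i = ev * y i ^ (k - 1)"
    using ev unfolding tensor_eigenvalue_def by blast
  define M where "M = Max ((\<lambda>i. cmod (y i) / t i) ` I)"
  have "M \<in> (\<lambda>i. cmod (y i) / t i) ` I"
    unfolding M_def using fin i0 by (intro Max_in) auto
  then obtain i where i: "i \<in> I" "M = cmod (y i) / t i" by auto
  have ratio: "cmod (y j) / t j \<le> M" if "j \<in> I" for j
    unfolding M_def using fin that by (intro Max_ge) auto
  have le: "cmod (y j) \<le> M * t j" if "j \<in> I" for j
    using ratio[OF that] pos[OF that] by (simp add: divide_le_eq)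
  have "0 < cmod (y i0) / t i0" using i0 pos by simp
  then have M: "M > 0" using ratio[OF i0(1)] by linarith
  have yi: "cmod (y i) = M * t i" using i pos[OF i(1)] by simp
  let ?L = "{js. length js = k - 1 \<and> set js \<subseteq> I}"
  \<comment> \<open>The equation for \<open>t\<close> is stated over the complex numbers;
    injectivity of \<open>of_real\<close> brings it to the reals, where it can be used in an
    inequality.\<close>
  have "of_real (\<Sum>js\<in>?L. a (i # js) * prod_list (map t js)) = (of_real (r * t i ^ (k - 1)) :: complex)"
    using eig[OF i(1)] unfolding tensor_apply_def T(1) prod_list_of_real by simp
  then have sum: "(\<Sum>js\<in>?L. a (i # js) * prod_list (map t js)) = r * t i ^ (k - 1)"
    using of_real_eq_iff by blast
  have "cmod ev * (M * t i) ^ (k - 1) = cmod (tensor_apply k I T y i)"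
    by (simp add: y[OF i(1)] norm_mult norm_power yi)
  also have "\<dots> \<le> (\<Sum>js\<in>?L. a (i # js) * (M ^ (k - 1) * prod_list (map t js)))"
    unfolding tensor_apply_def
  proof (rule sum_norm_le)
    fix js assume "js \<in> ?L"
    then have js: "length js = k - 1" "set js \<subseteq> I" by auto
    have "cmod (prod_list (map y js)) \<le> M ^ (k - 1) * prod_list (map t js)"
      using norm_prod_list_le[of js y M t] js le by auto
    then show "cmod (T (i # js) * prod_list (map y js)) \<le> a (i # js) * (M ^ (k - 1) * prod_list (map t js))"
      by (simp add: T norm_mult mult_left_mono)
  qed
  also have "\<dots> = M ^ (k - 1) * (r * t i ^ (k - 1))"
    unfolding sum[symmetric] by (simp add: sum_distrib_left mult_ac)
  finally have "cmod ev * (M * t i) ^ (k - 1) \<le> r * (M * t i) ^ (k - 1)"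
    by (simp add: power_mult_distrib mult_ac)
  moreover have "(M * t i) ^ (k - 1) > 0" using M pos[OF i(1)] by simp
  ultimately show ?thesis by simp
qed

text \<open>The real part serves as the real coefficient function \<open>a\<close> that
  \<open>tensor_eigenvalue_norm_le\<close> asks for.\<close>

lemma signless_laplacian_tensor_nonneg:
  "signless_laplacian_tensor k H js = of_real (Re (signless_laplacian_tensor k H js))"
  "Re (signless_laplacian_tensor k H js) \<ge> 0"
proof -
  have "signless_laplacian_tensor k H js =
    of_real ((if js = replicate k (hd js) then real (card {e \<in> H. hd js \<in> e}) else 0) +
      (if set js \<in> H then 1 / fact (k - 1) else 0))" (is "_ = of_real ?b")
    unfolding signless_laplacian_tensor_def degree_tensor_def adjacency_tensor_def by simp
  moreover have "?b \<ge> 0" by simp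
  ultimately show "signless_laplacian_tensor k H js = of_real (Re (signless_laplacian_tensor k H js))"
    "Re (signless_laplacian_tensor k H js) \<ge> 0"
    by (metis Re_complex_of_real)+
qed

section \<open>Edges of the graph and of its power\<close>

lemma simple_graph_finite_edges: "simple_graph V E \<Longrightarrow> finite E"
  unfolding simple_graph_def by (meson PowI finite_Pow_iff finite_subset subsetI)

lemma simple_graph_edge_neq: "simple_graph V E \<Longrightarrow> {u, v} \<in> E \<Longrightarrow> u \<noteq> v"
  unfolding simple_graph_def by fastforce

text \<open>An edge at \<open>v\<close> is determined by its other end. This turns regularity, which
  counts neighbours, into a count of edges, and sums over edges into sums over neighbours.\<close>

lemma edges_at_vertex:
  assumes "simple_graph V E"
  shows "bij_betw (\<lambda>u. {u, v}) {u \<in> V. {u, v} \<in> E} {e \<in> E. v \<in> e}"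
  unfolding bij_betw_def
proof (intro conjI)
  show "inj_on (\<lambda>u. {u, v}) {u \<in> V. {u, v} \<in> E}"
    by (auto simp: inj_on_def doubleton_eq_iff)
  show "(\<lambda>u. {u, v}) ` {u \<in> V. {u, v} \<in> E} = {e \<in> E. v \<in> e}"
  proof (intro subset_antisym subsetI)
    fix e assume e: "e \<in> {e \<in> E. v \<in> e}"
    then have "e \<subseteq> V" "card e = 2" using assms unfolding simple_graph_def by auto
    moreover from this obtain a b where "e = {a, b}" by (auto simp: card_2_iff)
    ultimately show "e \<in> (\<lambda>u. {u, v}) ` {u \<in> V. {u, v} \<in> E}" using e
      by (auto simp: image_iff insert_commute)
  qed auto
qed

text \<open>As a function of \<open>e\<close>, this allows sums over hyperedges to be reindexed by
  the edges of the graph.\<close>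

definition power_edge :: "nat \<Rightarrow> 'v set \<Rightarrow> 'v power_vertex set" where
  "power_edge k e = Orig ` e \<union> New e ` {1..k - 2}"

lemma power_edges_eq: "power_edges k E = power_edge k ` E"
  unfolding power_edges_def power_edge_def by auto

text \<open>The preimage under \<open>Orig\<close> recovers the underlying edge.\<close>

lemma inj_power_edge: "inj (power_edge k)"
proof (rule injI)
  fix e e' :: "'v set" assume "power_edge k e = power_edge k e'"
  then have "Orig -` power_edge k e = Orig -` power_edge k e'" by simp
  then show "e = e'" unfolding power_edge_def by auto
qed

lemma Orig_in_power_edge [simp]: "Orig v \<in> power_edge k e \<longleftrightarrow> v \<in> e"
  unfolding power_edge_def by auto

lemma New_in_power_edge [simp]: "New e' j \<in> power_edge k e \<longleftrightarrow> e' = e \<and> j \<in> {1..k - 2}"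
  unfolding power_edge_def by auto

lemma card_power_edge:
  assumes "card e = 2" "k \<ge> 2"
  shows "card (power_edge k e) = k"
proof -
  have "finite e" using assms card.infinite by fastforce
  then have "card (power_edge k e) = card (Orig ` e) + card (New e ` {1..k - 2})"
    unfolding power_edge_def by (intro card_Un_disjoint) auto
  also have "\<dots> = k" using assms by (simp add: card_image inj_on_def)
  finally show ?thesis .
qed

lemma finite_power_vertices:
  assumes "simple_graph V E"
  shows "finite (power_vertices k V E)"
proof -
  have "{New e j | e j. e \<in> E \<and> j \<in> {1..k-2}} = (\<lambda>(e, j). New e j) ` (E \<times> {1..k-2})"
    by auto
  then show ?thesis
    using assms simple_graph_finite_edges[OF assms]
    unfolding power_vertices_def simple_graph_def by simp
qed

lemma power_edge_subset:
  assumes "simple_graph V E" "e \<in> E"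
  shows "power_edge k e \<subseteq> power_vertices k V E"
  using assms unfolding power_edge_def power_vertices_def simple_graph_def by blast

section \<open>Eigenvectors of the power hypergraph\<close>

fun power_vector :: "complex \<Rightarrow> ('v \<Rightarrow> complex) \<Rightarrow> 'v power_vertex \<Rightarrow> complex" where
  "power_vector s t (Orig v) = t v ^ 2"
| "power_vector s t (New e j) = (\<Prod>v\<in>e. t v) / s"

text \<open>What remains is \<open>t u ^ 2\<close> and \<open>k - 2\<close> factors
  \<open>t u * t v / s\<close>. The exponents of \<open>t u\<close> add up to \<open>k\<close>, so
  summing over neighbours involves only the values \<open>t u ^ k\<close> of the graph
  eigenfunction.\<close>

lemma prod_power_edge_remove_Orig:
  assumes "u \<noteq> v" "k \<ge> 2"
  shows "(\<Prod>j\<in>power_edge k {u, v} - {Orig v}. power_vector s t j) = t u ^ k * t v ^ (k - 2) / s ^ (k - 2)"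
proof -
  have "power_edge k {u, v} - {Orig v} = insert (Orig u) (New {u, v} ` {1..k - 2})"
    unfolding power_edge_def using assms by auto
  then have "(\<Prod>j\<in>power_edge k {u, v} - {Orig v}. power_vector s t j) =
      t u ^ 2 * (\<Prod>j\<in>New {u, v} ` {1..k - 2}. power_vector s t j)"
    by (simp only:) (subst prod.insert; auto)
  also have "(\<Prod>j\<in>New {u, v} ` {1..k - 2}. power_vector s t j) = (t u * t v / s) ^ (k - 2)"
    using assms by (subst prod.reindex) (auto simp: inj_on_def)
  also have "t u ^ 2 * (t u * t v / s) ^ (k - 2) = t u ^ (2 + (k - 2)) * t v ^ (k - 2) / s ^ (k - 2)"
    by (simp only: power_add power_mult_distrib power_divide) simp
  also have "2 + (k - 2) = k" using assms by simp
  finally show ?thesis .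
qed

text \<open>With \<open>q\<close> the product of \<open>t\<close> over \<open>e\<close>, the two
  original vertices contribute \<open>q ^ 2\<close> and the other new ones
  \<open>(q / s) ^ (k - 3)\<close>. Writing \<open>q ^ 2\<close> as
  \<open>s ^ 2 * (q / s) ^ 2\<close> completes the exponent to \<open>k - 1\<close>.\<close>

lemma prod_power_edge_remove_New:
  assumes "card e = 2" "j \<in> {1..k - 2}" "s \<noteq> 0"
  shows "(\<Prod>i\<in>power_edge k e - {New e j}. power_vector s t i) = s\<^sup>2 * ((\<Prod>v\<in>e. t v) / s) ^ (k - 1)"
proof -
  have fe: "finite e" using assms card.infinite by fastforce
  let ?q = "\<Prod>v\<in>e. t v"
  have "power_edge k e - {New e j} = Orig ` e \<union> New e ` ({1..k - 2} - {j})"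
    unfolding power_edge_def by auto
  then have "(\<Prod>i\<in>power_edge k e - {New e j}. power_vector s t i) =
     (\<Prod>i\<in>Orig ` e. power_vector s t i) * (\<Prod>i\<in>New e ` ({1..k - 2} - {j}). power_vector s t i)"
    by (simp only:) (rule prod.union_disjoint; use fe in auto)
  also have "(\<Prod>i\<in>Orig ` e. power_vector s t i) = ?q\<^sup>2"
    by (subst prod.reindex) (auto simp: inj_on_def prod_power_distrib)
  also have "(\<Prod>i\<in>New e ` ({1..k - 2} - {j}). power_vector s t i) = (?q / s) ^ (k - 3)"
    using assms by (subst prod.reindex) (auto simp: inj_on_def)
  also have "?q\<^sup>2 * (?q / s) ^ (k - 3) = s\<^sup>2 * (?q / s) ^ (2 + (k - 3))"
    using assms by (simp only: power_add power_divide) simp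
  \<comment> \<open>A new vertex exists only for \<open>k \<ge> 3\<close>, so the subtraction is not
    truncated.\<close>
  also have "2 + (k - 3) = k - 1" using assms by auto
  finally show ?thesis .
qed

text \<open>The two conditions on \<open>s\<close> match the two kinds of vertices: the product
  condition balances the equation at an original vertex of degree \<open>d\<close>, and
  \<open>x = 1 + s\<^sup>2\<close> balances it at a new vertex of degree one.\<close>

lemma power_vector_eigen:
  assumes k: "k \<ge> 3" and G: "simple_graph V E" and reg: "regular_graph V E d"
    and z: "\<And>v. v \<in> V \<Longrightarrow> (\<Sum>u | u \<in> V \<and> {u, v} \<in> E. t u ^ k) = \<alpha> * t v ^ k"
    and s: "s \<noteq> 0" "s\<^sup>2 = x - 1" "(x - of_nat d) * s ^ (k - 2) = \<alpha>"
    and i: "i \<in> power_vertices k V E"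
  shows "tensor_apply k (power_vertices k V E) (signless_laplacian_tensor k (power_edges k E))
      (power_vector s t) i = x * power_vector s t i ^ (k - 1)"
proof -
  let ?I = "power_vertices k V E" and ?y = "power_vector s t"
  have card_e: "card e = 2" if "e \<in> E" for e using G that unfolding simple_graph_def by auto
  have "tensor_apply k ?I (signless_laplacian_tensor k (power_edges k E)) ?y i =
      of_nat (card {h \<in> power_edges k E. i \<in> h}) * ?y i ^ (k - 1)
      + (\<Sum>h\<in>{h \<in> power_edges k E. i \<in> h}. \<Prod>j\<in>h - {i}. ?y j)"
    using k power_edge_subset[OF G] card_e
    by (intro signless_laplacian_tensor_apply finite_power_vertices[OF G] i)
      (auto simp: power_edges_eq card_power_edge)
  also have "{h \<in> power_edges k E. i \<in> h} = power_edge k ` {e \<in> E. i \<in> power_edge k e}"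
    by (auto simp: power_edges_eq)
  also have "card (power_edge k ` {e \<in> E. i \<in> power_edge k e}) = card {e \<in> E. i \<in> power_edge k e}"
    by (intro card_image inj_on_subset[OF inj_power_edge]) auto
  also have "(\<Sum>h\<in>power_edge k ` {e \<in> E. i \<in> power_edge k e}. \<Prod>j\<in>h - {i}. ?y j) =
      (\<Sum>e\<in>{e \<in> E. i \<in> power_edge k e}. \<Prod>j\<in>power_edge k e - {i}. ?y j)"
    by (subst sum.reindex) (auto intro: inj_on_subset[OF inj_power_edge])
  finally have Q: "tensor_apply k ?I (signless_laplacian_tensor k (power_edges k E)) ?y i =
      of_nat (card {e \<in> E. i \<in> power_edge k e}) * ?y i ^ (k - 1)
      + (\<Sum>e\<in>{e \<in> E. i \<in> power_edge k e}. \<Prod>j\<in>power_edge k e - {i}. ?y j)" .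
  show ?thesis
  proof (cases i)
    case (Orig v)
    then have v: "v \<in> V" using i unfolding power_vertices_def by auto
    note bij = edges_at_vertex[OF G, of v]
    have "card {e \<in> E. i \<in> power_edge k e} = d"
      using bij_betw_same_card[OF bij] reg v Orig unfolding regular_graph_def by simp
    moreover have "(\<Sum>e\<in>{e \<in> E. i \<in> power_edge k e}. \<Prod>j\<in>power_edge k e - {i}. ?y j) =
        (\<Sum>u | u \<in> V \<and> {u, v} \<in> E. \<Prod>j\<in>power_edge k {u, v} - {Orig v}. ?y j)"
      using sum.reindex_bij_betw[OF bij, of "\<lambda>e. \<Prod>j\<in>power_edge k e - {Orig v}. ?y j"] Orig by simp
    moreover have "\<dots> = (\<Sum>u | u \<in> V \<and> {u, v} \<in> E. t u ^ k * t v ^ (k - 2) / s ^ (k - 2))"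
      using k by (intro sum.cong refl prod_power_edge_remove_Orig)
        (auto dest: simple_graph_edge_neq[OF G])
    moreover have "\<dots> = \<alpha> * t v ^ k * t v ^ (k - 2) / s ^ (k - 2)"
      by (simp add: sum_distrib_right[symmetric] sum_divide_distrib[symmetric] z[OF v])
    moreover have "\<dots> = (x - of_nat d) * (t v ^ k * t v ^ (k - 2))"
      using s by (simp add: field_simps s(3)[symmetric])
    \<comment> \<open>The entry at \<open>Orig v\<close> is the square of \<open>t v\<close>, so its
      power \<open>k - 1\<close> has exactly this exponent in \<open>t v\<close>.\<close>
    moreover have "k + (k - 2) = 2 * (k - 1)" using k by simp
    then have "t v ^ k * t v ^ (k - 2) = ?y i ^ (k - 1)"
      by (simp only: Orig power_vector.simps power_add[symmetric] power_mult[symmetric])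
    ultimately show ?thesis unfolding Q by (simp add: algebra_simps)
  next
    case (New e j)
    then have e: "e \<in> E" "j \<in> {1..k - 2}" using i unfolding power_vertices_def by auto
    \<comment> \<open>A new vertex lies in its own hyperedge only, so its degree is one.\<close>
    then have "{e \<in> E. i \<in> power_edge k e} = {e}" using New by auto
    then have "tensor_apply k ?I (signless_laplacian_tensor k (power_edges k E)) ?y i =
        ?y i ^ (k - 1) + (\<Prod>j'\<in>power_edge k e - {New e j}. ?y j')"
      unfolding Q using New by simp
    also have "\<dots> = ?y i ^ (k - 1) + s\<^sup>2 * ?y i ^ (k - 1)"
      using prod_power_edge_remove_New[OF card_e[OF e(1)] e(2) s(1)] New by simp
    finally show ?thesis by (simp add: s(2) algebra_simps)
  qed
qed

section \<open>Graph eigenfunctions and roots of the equation\<close>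

lemma is_root_imp_sqrt:
  assumes "k \<ge> 3" "is_root k d \<alpha> x" "\<alpha> \<noteq> 0"
  obtains s where "s \<noteq> 0" "s\<^sup>2 = x - 1" "(x - of_nat d) * s ^ (k - 2) = \<alpha>"
proof -
  obtain p where p: "p \<in> half_powers (k - 2) (x - 1)" "(x - of_nat d) * p = \<alpha>"
    using assms(2) unfolding is_root_def by auto
  have "\<exists>s. s\<^sup>2 = x - 1 \<and> s ^ (k - 2) = p"
  proof (cases "even (k - 2)")
    case True
    \<comment> \<open>For an even exponent both square roots give the same power, so the principal
      one serves as \<open>s\<close>.\<close>
    then have "csqrt (x - 1) ^ (k - 2) = (csqrt (x - 1))\<^sup>2 ^ ((k - 2) div 2)"
      by (metis dvd_mult_div_cancel power_mult)
    then show ?thesis using p(1) True unfolding half_powers_def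
      by (intro exI[of _ "csqrt (x - 1)"]) simp
  next
    case False
    then show ?thesis using p(1) unfolding half_powers_def by auto
  qed
  then obtain s where s: "s\<^sup>2 = x - 1" "s ^ (k - 2) = p" by blast
  \<comment> \<open>Since \<open>k - 2 > 0\<close>, \<open>s = 0\<close> would give
    \<open>p = 0\<close> and hence \<open>\<alpha> = 0\<close>.\<close>
  moreover have "s \<noteq> 0" using s p assms by (auto simp: power_0_left)
  ultimately show ?thesis using p that by blast
qed

lemma graph_eigenvalue_imp_eigenfunction:
  assumes "graph_eigenvalue V E \<alpha>"
  obtains z where "\<exists>v\<in>V. z v \<noteq> 0"
    "\<And>v. v \<in> V \<Longrightarrow> (\<Sum>u | u \<in> V \<and> {u, v} \<in> E. z u) = \<alpha> * z v"
proof -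
  obtain vs w where vs: "distinct vs" "set vs = V"
    and w: "eigenvector (adjacency_matrix vs E) w \<alpha>"
    using assms unfolding graph_eigenvalue_def eigenvalue_def by blast
  let ?n = "length vs"
  have dimw: "w \<in> carrier_vec ?n" and w0: "w \<noteq> 0\<^sub>v ?n"
    and eq: "adjacency_matrix vs E *\<^sub>v w = \<alpha> \<cdot>\<^sub>v w"
    using w unfolding eigenvector_def adjacency_matrix_def by auto
  have bij: "bij_betw ((!) vs) {..<?n} V"
    using bij_betw_nth[OF vs(1), of "{..<?n}" V] vs(2) by simp
  \<comment> \<open>The eigenvector is transported to the vertices along the inverse of the
    enumeration \<open>vs\<close>.\<close>
  define z where "z v = w $ (the_inv_into {..<?n} ((!) vs) v)" for v
  have z: "z (vs ! i) = w $ i" if "i < ?n" for i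
    unfolding z_def using the_inv_into_f_f[OF bij_betw_imp_inj_on[OF bij]] that by simp
  show ?thesis
  proof (rule that[of z])
    have "\<exists>i<?n. w $ i \<noteq> 0"
    proof (rule ccontr)
      assume "\<not> ?thesis"
      then have "w = 0\<^sub>v ?n" using dimw by (intro eq_vecI) auto
      then show False using w0 by simp
    qed
    then obtain i where "i < ?n" "w $ i \<noteq> 0" by blast
    then show "\<exists>v\<in>V. z v \<noteq> 0" using z vs(2) by (intro bexI[of _ "vs ! i"]) auto
  next
    fix v assume v: "v \<in> V"
    then obtain i where i: "i < ?n" "v = vs ! i" using vs(2) by (metis in_set_conv_nth)
    have finV: "finite V" using vs by auto
    have "(\<Sum>u | u \<in> V \<and> {u, v} \<in> E. z u) = (\<Sum>u\<in>V. if {u, v} \<in> E then z u else 0)"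
      using finV by (subst sum.inter_filter[symmetric]) auto
    also have "\<dots> = (\<Sum>j<?n. if {vs ! j, v} \<in> E then z (vs ! j) else 0)"
      by (rule sum.reindex_bij_betw[OF bij, symmetric])
    also have "\<dots> = (\<Sum>j<?n. (if {vs ! i, vs ! j} \<in> E then 1 else 0) * w $ j)"
      using z i by (intro sum.cong) (auto simp: insert_commute)
    also have "\<dots> = (adjacency_matrix vs E *\<^sub>v w) $ i"
      using i dimw unfolding adjacency_matrix_def
      by (simp add: scalar_prod_def atLeast0LessThan)
    also have "\<dots> = \<alpha> * z v" using i dimw z eq by simp
    finally show "(\<Sum>u | u \<in> V \<and> {u, v} \<in> E. z u) = \<alpha> * z v" .
  qed
qed

lemma complex_root_exists:
  assumes "n > 0"
  shows "\<exists>w :: complex. w ^ n = z"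
proof
  show "rcis (root n (cmod z)) (Arg z / real n) ^ n = z"
    using assms by (simp add: DeMoivre2 real_root_pow_pos2 rcis_cmod_Arg)
qed

text \<open>The left side is \<open>0\<close> at \<open>d\<close> and at least \<open>d\<close> at
  \<open>2 * d\<close>, so the intermediate value theorem gives a root between them. To the right of
  this root both factors grow strictly, which excludes a larger one.\<close>

lemma largest_real_root_exists:
  fixes d k :: nat
  assumes k: "k \<ge> 3" and d: "d \<ge> 1"
  obtains r where "r > real d" "(r - real d) * sqrt (r - 1) ^ (k - 2) = real d"
    "is_largest_real_root k d (of_nat d) r"
proof -
  let ?f = "\<lambda>x::real. (x - real d) * sqrt (x - 1) ^ (k - 2)"
  have "sqrt (real (2 * d) - 1) ^ (k - 2) \<ge> 1"
    using d by (intro one_le_power) simp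
  then have "?f (real (2 * d)) \<ge> real d"
    using mult_left_mono[of 1 "sqrt (real (2 * d) - 1) ^ (k - 2)" "real d"] by simp
  then have "\<exists>r\<ge>real d. r \<le> real (2 * d) \<and> ?f r = real d"
    by (intro IVT') (auto intro!: continuous_intros)
  then obtain r where r: "r \<ge> real d" "?f r = real d" by blast
  moreover have "r \<noteq> real d" using r d by auto
  ultimately have rd: "r > real d" by simp
  \<comment> \<open>For \<open>x \<ge> 1\<close> the half power is the nonnegative real one, so
    being a root is a real equation. Candidates beyond \<open>r\<close> fall in this range because
    \<open>r > d \<ge> 1\<close>.\<close>
  have root_iff: "is_real_root k d (of_nat d) x \<longleftrightarrow> ?f x = real d" if "x \<ge> 1" for x
  proof -
    have "is_real_root k d (of_nat d) x \<longleftrightarrow> of_real (?f x) = (of_real (real d) :: complex)"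
      unfolding is_real_root_def real_half_powers_def using that by simp
    then show ?thesis using of_real_eq_iff by blast
  qed
  have "x \<le> r" if x: "is_real_root k d (of_nat d) x" for x
  proof (rule ccontr)
    assume "\<not> x \<le> r"
    then have xr: "x > r" by simp
    have "sqrt (r - 1) ^ (k - 2) < sqrt (x - 1) ^ (k - 2)"
      using xr rd d k by (intro power_strict_mono) auto
    then have "?f r < ?f x"
      using xr rd d by (intro mult_strict_mono') auto
    moreover have "?f x = real d" using x root_iff[of x] xr rd d by auto
    ultimately show False using r by simp
  qed
  then have "is_largest_real_root k d (of_nat d) r"
    unfolding is_largest_real_root_def using root_iff[of r] r d by auto
  then show ?thesis using that rd r by blast
qed

section \<open>Eigenvalues from roots, and the spectral radius\<close>

theorem theorem4p8:
  fixes V :: "'v set" and E :: "'v set set" and k d :: nat and \<alpha> :: complex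
  assumes "k \<ge> 3"
    and "simple_graph V E"
    and "regular_graph V E d"
    and "graph_eigenvalue V E \<alpha>"
    and "\<alpha> \<noteq> 0"
  shows "(\<forall>x. is_root k d \<alpha> x \<longrightarrow>
            tensor_eigenvalue k (power_vertices k V E)
              (signless_laplacian_tensor k (power_edges k E)) x)
       \<and> (\<exists>r. is_largest_real_root k d (of_nat d) r \<and>
            is_tensor_spectral_radius k (power_vertices k V E)
              (signless_laplacian_tensor k (power_edges k E)) r)"
proof -
  let ?I = "power_vertices k V E" and ?Q = "signless_laplacian_tensor k (power_edges k E)"
  obtain z v0 where v0: "v0 \<in> V" "z v0 \<noteq> 0"
    and z: "\<And>v. v \<in> V \<Longrightarrow> (\<Sum>u | u \<in> V \<and> {u, v} \<in> E. z u) = \<alpha> * z v"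
    using graph_eigenvalue_imp_eigenfunction[OF assms(4)] by metis
  have I0: "Orig v0 \<in> ?I" using v0 unfolding power_vertices_def by auto
  have "\<exists>t. \<forall>v. t v ^ k = z v"
    using complex_root_exists[of k] assms(1) by (intro choice) auto
  then obtain t where t: "\<And>v. t v ^ k = z v" by blast
  have t0: "t v0 \<noteq> 0" using t[of v0] v0 assms(1) by (auto simp: power_0_left)
  have part1: "tensor_eigenvalue k ?I ?Q x" if x: "is_root k d \<alpha> x" for x
  proof -
    obtain s where s: "s \<noteq> 0" "s\<^sup>2 = x - 1" "(x - of_nat d) * s ^ (k - 2) = \<alpha>"
      using is_root_imp_sqrt[OF assms(1) x assms(5)] .
    have "power_vector s t (Orig v0) \<noteq> 0" using t0 by simp
    moreover have "tensor_apply k ?I ?Q (power_vector s t) i = x * power_vector s t i ^ (k - 1)"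
      if "i \<in> ?I" for i
      using power_vector_eigen[OF assms(1-3) _ s that, of t] z t by simp
    ultimately show ?thesis using I0 unfolding tensor_eigenvalue_def by blast
  qed
  \<comment> \<open>In a graph without edges the eigenfunction equation at \<open>v0\<close> would
    read \<open>0 = \<alpha> * z v0\<close>.\<close>
  have "d \<noteq> 0"
  proof
    assume "d = 0"
    then have "card {u \<in> V. {u, v0} \<in> E} = 0"
      using assms(3) v0 unfolding regular_graph_def by simp
    moreover have "finite V" using assms(2) unfolding simple_graph_def by simp
    ultimately have "{u. u \<in> V \<and> {u, v0} \<in> E} = {}" by simp
    then show False using z[OF v0(1)] v0 assms(5) by (simp only:) simp
  qed
  then obtain r where r: "r > real d" "(r - real d) * sqrt (r - 1) ^ (k - 2) = real d"
    and lr: "is_largest_real_root k d (of_nat d) r"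
    using largest_real_root_exists[OF assms(1), of d] by auto
  let ?c = "sqrt (r - 1)"
  have c: "?c > 0" "?c\<^sup>2 = r - 1" using r \<open>d \<noteq> 0\<close> by auto
  \<comment> \<open>The comparison lemma takes a real positive vector; \<open>\<tau>\<close> is the
    real form of \<open>power_vector\<close> for \<open>t = 1\<close> and
    \<open>s = ?c\<close>.\<close>
  define \<tau> :: "'v power_vertex \<Rightarrow> real" where
    "\<tau> i = (case i of Orig _ \<Rightarrow> 1 | New _ _ \<Rightarrow> 1 / ?c)" for i
  have \<tau>: "power_vector (of_real ?c) (\<lambda>_. 1) = (\<lambda>i. of_real (\<tau> i))"
    by (rule ext) (simp add: \<tau>_def split: power_vertex.split)
  have \<tau>pos: "\<tau> i > 0" for i using c by (simp add: \<tau>_def split: power_vertex.split)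
  have eig: "tensor_apply k ?I ?Q (\<lambda>i. of_real (\<tau> i)) i = of_real r * of_real (\<tau> i) ^ (k - 1)"
    if "i \<in> ?I" for i
  proof -
    \<comment> \<open>By regularity the constant function \<open>1\<close> is an eigenfunction of
      the graph for \<open>d\<close>.\<close>
    have "(\<Sum>u | u \<in> V \<and> {u, v} \<in> E. 1 ^ k) = (of_nat d :: complex) * 1 ^ k" if "v \<in> V" for v
      using assms(3) that unfolding regular_graph_def by simp
    moreover have "(of_real ?c :: complex) \<noteq> 0" using c by simp
    moreover have "(of_real ?c :: complex)\<^sup>2 = of_real r - 1"
      using c(2) by (metis of_real_1 of_real_diff of_real_power)
    moreover have "(of_real r - of_nat d) * of_real ?c ^ (k - 2) = (of_nat d :: complex)"
      using arg_cong[OF r(2), of complex_of_real] by simp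
    ultimately show ?thesis
      using power_vector_eigen[OF assms(1-3), of "\<lambda>_. 1" "of_nat d" "of_real ?c" "of_real r" i] that \<tau>
      by simp
  qed
  \<comment> \<open>The value \<open>r\<close> is itself an eigenvalue, so the bound proved next is
    attained.\<close>
  have "tensor_eigenvalue k ?I ?Q (of_real r)"
    unfolding tensor_eigenvalue_def
    by (rule exI[of _ "\<lambda>i. of_real (\<tau> i)"]) (use I0 eig \<tau>pos in \<open>auto simp: less_imp_neq[symmetric]\<close>)
  moreover have "cmod (of_real r) = r" using r by simp
  moreover have "cmod ev \<le> r" if "tensor_eigenvalue k ?I ?Q ev" for ev
    by (rule tensor_eigenvalue_norm_le[OF finite_power_vertices[OF assms(2)] \<tau>pos
        signless_laplacian_tensor_nonneg eig that])
  ultimately have "is_tensor_spectral_radius k ?I ?Q r"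
    unfolding is_tensor_spectral_radius_def by blast
  then show ?thesis using part1 lr by blast
qed

end
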